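(* Let $\Delta$ be a twin building of type $(W,S)$ and let $\theta$ be an automorphism of $\Delta$. If $\theta$ is $\{s\}$-opposite for some $s\in S$, then $\theta$ is $S$-opposite, i.e. $\theta$ maps every chamber to an opposite chamber.
   Context: $(W,S)$ is a Coxeter system with $S$ finite and $W$ irreducible. A twin building consists of two buildings $\Delta^+,\Delta^-$ of type $(W,S)$ with a codistance $\delta^*$ satisfying the usual twin building axioms. A $K$-residue of $\Delta^\epsilon$ is a set $\{D\in\Delta^\epsilon:\delta(C,D)\in W_K\}$. Chambers in different halves are opposite if $\delta^*(C,D)=1$; residues $P,Q$ in different halves are opposite if every chamber of $P$ is opposite some chamber of $Q$. An automorphism is a bijection of chambers preserving adjacency and opposition (not necessarily type preserving). For $J\subseteq S$, $\theta$ is called $J$-opposite if it maps every $S\setminus J$-residue to an opposite residue. *)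

theory Defs
  imports "HOL-Algebra.Algebra"
begin

section \<open>Coxeter systems\<close>

definition word_prod :: "('w, 'x) monoid_scheme \<Rightarrow> 'w list \<Rightarrow> 'w" where
  "word_prod W ws = foldr (\<lambda>x y. x \<otimes>\<^bsub>W\<^esub> y) ws \<one>\<^bsub>W\<^esub>"

text \<open>
  The congruence on words over \<open>S\<close> generated by the relations \<open>(st)\<^sup>m = 1\<close>, where \<open>m\<close> is the
  order of \<open>st\<close>.  The library sets the order to \<open>0\<close> when it is infinite, so that
  no relation is imposed in that case; \<open>s = t\<close> gives \<open>m = 1\<close>, i.e. the relation \<open>ss = 1\<close>, so
  formal inverses of generators are not needed.
\<close>

inductive word_equiv :: "('w, 'x) monoid_scheme \<Rightarrow> 'w set \<Rightarrow> 'w list \<Rightarrow> 'w list \<Rightarrow> bool"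
  for W S where
  relation: "s \<in> S \<Longrightarrow> t \<in> S \<Longrightarrow>
      word_equiv W S (us @ concat (replicate (group.ord W (s \<otimes>\<^bsub>W\<^esub> t)) [s, t]) @ vs) (us @ vs)"
| refl: "word_equiv W S ws ws"
| sym: "word_equiv W S us vs \<Longrightarrow> word_equiv W S vs us"
| trans: "word_equiv W S us vs \<Longrightarrow> word_equiv W S vs ws \<Longrightarrow> word_equiv W S us ws"

locale coxeter_system = group W for W (structure) +
  fixes S
  assumes gens_closed: "S \<subseteq> carrier W"
    and generates: "generate W S = carrier W"
    and order_two: "s \<in> S \<Longrightarrow> ord s = 2"
    and presentation: "set ws \<subseteq> S \<Longrightarrow> word_prod W ws = \<one> \<Longrightarrow> word_equiv W S ws []"

definition cox_length :: "('w, 'x) monoid_scheme \<Rightarrow> 'w set \<Rightarrow> 'w \<Rightarrow> nat" where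
  "cox_length W S w =
     (LEAST n. \<exists>ws. set ws \<subseteq> S \<and> length ws = n \<and> word_prod W ws = w)"

definition coxeter_diagram :: "('w, 'x) monoid_scheme \<Rightarrow> 'w set \<Rightarrow> ('w \<times> 'w) set" where
  "coxeter_diagram W S =
     {(s, t). s \<in> S \<and> t \<in> S \<and> s \<noteq> t \<and> group.ord W (s \<otimes>\<^bsub>W\<^esub> t) \<noteq> 2}"

definition irreducible_coxeter :: "('w, 'x) monoid_scheme \<Rightarrow> 'w set \<Rightarrow> bool" where
  "irreducible_coxeter W S \<longleftrightarrow> (\<forall>s\<in>S. \<forall>t\<in>S. (s, t) \<in> (coxeter_diagram W S)\<^sup>*)"


section \<open>Buildings and twin buildings\<close>

locale building = coxeter_system W S for W (structure) and S +
  fixes Ch :: "'c set" and \<delta> :: "'c \<Rightarrow> 'c \<Rightarrow> 'a"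
  assumes chambers_nonempty: "Ch \<noteq> {}"
    and dist_closed: "C \<in> Ch \<Longrightarrow> D \<in> Ch \<Longrightarrow> \<delta> C D \<in> carrier W"
    and WD1: "C \<in> Ch \<Longrightarrow> D \<in> Ch \<Longrightarrow> \<delta> C D = \<one> \<longleftrightarrow> C = D"
    and WD2: "C \<in> Ch \<Longrightarrow> D \<in> Ch \<Longrightarrow> C' \<in> Ch \<Longrightarrow> s \<in> S \<Longrightarrow> \<delta> C' C = s \<Longrightarrow>
        \<delta> C' D \<in> {s \<otimes> \<delta> C D, \<delta> C D}"
    and WD2_longer: "C \<in> Ch \<Longrightarrow> D \<in> Ch \<Longrightarrow> C' \<in> Ch \<Longrightarrow> s \<in> S \<Longrightarrow> \<delta> C' C = s \<Longrightarrow>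
        cox_length W S (s \<otimes> \<delta> C D) = cox_length W S (\<delta> C D) + 1 \<Longrightarrow> \<delta> C' D = s \<otimes> \<delta> C D"
    and WD3: "C \<in> Ch \<Longrightarrow> D \<in> Ch \<Longrightarrow> s \<in> S \<Longrightarrow>
        \<exists>C'\<in>Ch. \<delta> C' C = s \<and> \<delta> C' D = s \<otimes> \<delta> C D"

text \<open>
  The two halves are indexed by a sign \<open>\<epsilon> :: bool\<close> (\<open>True\<close> for \<open>+\<close>), and realised as disjoint
  sets of one type, so that an automorphism is a map on \<open>Ch True \<union> Ch False\<close>.  The
  codistance \<open>\<delta>s\<close> is meaningful only for chambers in different halves.
\<close>

locale twin_building = coxeter_system W S for W (structure) and S +
  fixes Ch :: "bool \<Rightarrow> 'c set" and \<delta> :: "bool \<Rightarrow> 'c \<Rightarrow> 'c \<Rightarrow> 'a" and \<delta>s :: "'c \<Rightarrow> 'c \<Rightarrow> 'a"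
  assumes halves: "building W S (Ch \<epsilon>) (\<delta> \<epsilon>)"
    and disjoint: "Ch True \<inter> Ch False = {}"
    and codist_closed: "C \<in> Ch \<epsilon> \<Longrightarrow> D \<in> Ch (\<not> \<epsilon>) \<Longrightarrow> \<delta>s C D \<in> carrier W"
    and Tw1: "C \<in> Ch \<epsilon> \<Longrightarrow> D \<in> Ch (\<not> \<epsilon>) \<Longrightarrow> \<delta>s C D = inv (\<delta>s D C)"
    and Tw2: "C \<in> Ch \<epsilon> \<Longrightarrow> D \<in> Ch (\<not> \<epsilon>) \<Longrightarrow> C' \<in> Ch \<epsilon> \<Longrightarrow> s \<in> S \<Longrightarrow> \<delta> \<epsilon> C' C = s \<Longrightarrow>
        cox_length W S (s \<otimes> \<delta>s C D) < cox_length W S (\<delta>s C D) \<Longrightarrow> \<delta>s C' D = s \<otimes> \<delta>s C D"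
    and Tw3: "C \<in> Ch \<epsilon> \<Longrightarrow> D \<in> Ch (\<not> \<epsilon>) \<Longrightarrow> s \<in> S \<Longrightarrow>
        \<exists>C'\<in>Ch \<epsilon>. \<delta> \<epsilon> C' C = s \<and> \<delta>s C' D = s \<otimes> \<delta>s C D"


section \<open>Residues, opposition and automorphisms\<close>

definition twin_chambers :: "(bool \<Rightarrow> 'c set) \<Rightarrow> 'c set" where
  "twin_chambers Ch = Ch True \<union> Ch False"

definition is_residue ::
  "('w, 'x) monoid_scheme \<Rightarrow> 'w set \<Rightarrow> (bool \<Rightarrow> 'c set) \<Rightarrow> (bool \<Rightarrow> 'c \<Rightarrow> 'c \<Rightarrow> 'w) \<Rightarrow>
   'w set \<Rightarrow> bool \<Rightarrow> 'c set \<Rightarrow> bool" where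
  "is_residue W S Ch \<delta> K \<epsilon> R \<longleftrightarrow>
     K \<subseteq> S \<and> (\<exists>C\<in>Ch \<epsilon>. R = {D \<in> Ch \<epsilon>. \<delta> \<epsilon> C D \<in> generate W K})"

definition adjacent ::
  "'w set \<Rightarrow> (bool \<Rightarrow> 'c set) \<Rightarrow> (bool \<Rightarrow> 'c \<Rightarrow> 'c \<Rightarrow> 'w) \<Rightarrow> 'c \<Rightarrow> 'c \<Rightarrow> bool" where
  "adjacent S Ch \<delta> C D \<longleftrightarrow> (\<exists>\<epsilon>. C \<in> Ch \<epsilon> \<and> D \<in> Ch \<epsilon> \<and> \<delta> \<epsilon> C D \<in> S)"

definition opposite ::
  "('w, 'x) monoid_scheme \<Rightarrow> (bool \<Rightarrow> 'c set) \<Rightarrow> ('c \<Rightarrow> 'c \<Rightarrow> 'w) \<Rightarrow> 'c \<Rightarrow> 'c \<Rightarrow> bool" where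
  "opposite W Ch \<delta>s C D \<longleftrightarrow> (\<exists>\<epsilon>. C \<in> Ch \<epsilon> \<and> D \<in> Ch (\<not> \<epsilon>) \<and> \<delta>s C D = \<one>\<^bsub>W\<^esub>)"

definition opposite_residues ::
  "('w, 'x) monoid_scheme \<Rightarrow> 'w set \<Rightarrow> (bool \<Rightarrow> 'c set) \<Rightarrow> (bool \<Rightarrow> 'c \<Rightarrow> 'c \<Rightarrow> 'w) \<Rightarrow>
   ('c \<Rightarrow> 'c \<Rightarrow> 'w) \<Rightarrow> 'c set \<Rightarrow> 'c set \<Rightarrow> bool" where
  "opposite_residues W S Ch \<delta> \<delta>s P Q \<longleftrightarrow>
     (\<exists>\<epsilon> K L. is_residue W S Ch \<delta> K \<epsilon> P \<and> is_residue W S Ch \<delta> L (\<not> \<epsilon>) Q) \<and>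
     (\<forall>C\<in>P. \<exists>D\<in>Q. opposite W Ch \<delta>s C D)"

definition twin_automorphism ::
  "('w, 'x) monoid_scheme \<Rightarrow> 'w set \<Rightarrow> (bool \<Rightarrow> 'c set) \<Rightarrow> (bool \<Rightarrow> 'c \<Rightarrow> 'c \<Rightarrow> 'w) \<Rightarrow>
   ('c \<Rightarrow> 'c \<Rightarrow> 'w) \<Rightarrow> ('c \<Rightarrow> 'c) \<Rightarrow> bool" where
  "twin_automorphism W S Ch \<delta> \<delta>s \<theta> \<longleftrightarrow>
     bij_betw \<theta> (twin_chambers Ch) (twin_chambers Ch) \<and>
     (\<forall>C\<in>twin_chambers Ch. \<forall>D\<in>twin_chambers Ch.
        (adjacent S Ch \<delta> (\<theta> C) (\<theta> D) \<longleftrightarrow> adjacent S Ch \<delta> C D) \<and>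
        (opposite W Ch \<delta>s (\<theta> C) (\<theta> D) \<longleftrightarrow> opposite W Ch \<delta>s C D))"

definition J_opposite ::
  "('w, 'x) monoid_scheme \<Rightarrow> 'w set \<Rightarrow> (bool \<Rightarrow> 'c set) \<Rightarrow> (bool \<Rightarrow> 'c \<Rightarrow> 'c \<Rightarrow> 'w) \<Rightarrow>
   ('c \<Rightarrow> 'c \<Rightarrow> 'w) \<Rightarrow> 'w set \<Rightarrow> ('c \<Rightarrow> 'c) \<Rightarrow> bool" where
  "J_opposite W S Ch \<delta> \<delta>s J \<theta> \<longleftrightarrow>
     (\<forall>\<epsilon> R. is_residue W S Ch \<delta> (S - J) \<epsilon> R \<longrightarrow> opposite_residues W S Ch \<delta> \<delta>s R (\<theta> ` R))"

end

theory Submission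
  imports Defs
begin

text \<open>
  Write \<open>w(C)\<close> for the codistance from \<open>C\<close> to \<open>\<theta> C\<close>. Being \<open>{s}\<close>-opposite forces \<open>w(C) \<in> W\<^sub>K\<close>
  for every chamber \<open>C\<close>, where \<open>K = S - {s}\<close>. If this holds for some \<open>K\<close> and \<open>t \<notin> K\<close>, choose \<open>C'\<close>
  that is \<open>t\<close>-adjacent to \<open>C\<close> and has codistance \<open>t w(C)\<close> to \<open>\<theta> C\<close>; then \<open>w(C')\<close> is \<open>t w(C)\<close> or
  \<open>t w(C) u\<close> with \<open>u\<close> the type of the adjacency of \<open>\<theta> C\<close> and \<open>\<theta> C'\<close>. As \<open>w(C') \<in> W\<^sub>K\<close>, this
  leaves only \<open>u = t\<close> and \<open>t w(C) t \<in> W\<^sub>K\<close>, which happens only if \<open>w(C)\<close> lies in the subgroup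
  generated by the elements of \<open>K\<close> that commute with \<open>t\<close>. Since \<open>W\<close> is irreducible, some \<open>t \<notin> K\<close>
  fails to commute with all of \<open>K\<close> as long as \<open>K\<close> is nonempty, so \<open>K\<close> can be shrunk down to the
  empty set. No map on types is needed, since \<open>\<theta>\<close> need not induce one.

  The facts on Coxeter groups come from the inversion set \<open>N(w)\<close>: the reflections that occur an
  odd number of times among the \<open>s\<^sub>1 \<dots> s\<^sub>i\<^sub>-\<^sub>1 s\<^sub>i s\<^sub>i\<^sub>-\<^sub>1 \<dots> s\<^sub>1\<close> of a word \<open>s\<^sub>1 \<dots> s\<^sub>n\<close> for \<open>w\<close>. It
  satisfies \<open>N(u v) = N(u) + u N(v) u\<^sup>-\<^sup>1\<close>, where \<open>+\<close> is symmetric difference.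
\<close>

section \<open>Words and their reflection sequences\<close>

definition odd_elems :: "'a list \<Rightarrow> 'a set"
  where "odd_elems xs = {x. odd (count_list xs x)}"

lemma odd_elems_subset: "odd_elems xs \<subseteq> set xs"
  by (auto simp: odd_elems_def intro: ccontr)

lemma odd_elems_Nil [simp]: "odd_elems [] = {}"
  by (simp add: odd_elems_def)

lemma odd_elems_append: "odd_elems (xs @ ys) = sym_diff (odd_elems xs) (odd_elems ys)"
  by (auto simp: odd_elems_def)

lemma odd_elems_distinct: "distinct xs \<Longrightarrow> odd_elems xs = set xs"
  by (induction xs) (auto simp: odd_elems_def)

lemma odd_elems_map:
  assumes "inj_on f (set xs)"
  shows "odd_elems (map f xs) = f ` odd_elems xs"
proof -
  have "f x \<in> odd_elems (map f xs) \<longleftrightarrow> x \<in> odd_elems xs" if "x \<in> set xs" for x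
    using count_list_inj_map[OF assms that] by (simp add: odd_elems_def)
  then show ?thesis
    using odd_elems_subset[of xs] odd_elems_subset[of "map f xs"] by auto
qed

definition conjugate :: "('w, 'x) monoid_scheme \<Rightarrow> 'w \<Rightarrow> 'w \<Rightarrow> 'w"
  where "conjugate W x y = x \<otimes>\<^bsub>W\<^esub> y \<otimes>\<^bsub>W\<^esub> inv\<^bsub>W\<^esub> x"

fun reflections :: "('w, 'x) monoid_scheme \<Rightarrow> 'w list \<Rightarrow> 'w list" where
  "reflections W [] = []"
| "reflections W (x # xs) = x # map (conjugate W x) (reflections W xs)"

lemma length_reflections [simp]: "length (reflections W ws) = length ws"
  by (induction ws) auto

lemma word_prod_Nil [simp]: "word_prod W [] = \<one>\<^bsub>W\<^esub>"
  by (simp add: word_prod_def)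

lemma word_prod_Cons [simp]: "word_prod W (x # xs) = x \<otimes>\<^bsub>W\<^esub> word_prod W xs"
  by (simp add: word_prod_def)

context group
begin

lemma conjugate_closed [simp]:
  "x \<in> carrier G \<Longrightarrow> y \<in> carrier G \<Longrightarrow> conjugate G x y \<in> carrier G"
  by (simp add: conjugate_def)

lemma conjugate_one [simp]: "y \<in> carrier G \<Longrightarrow> conjugate G \<one> y = y"
  by (simp add: conjugate_def)

lemma conjugate_self [simp]: "x \<in> carrier G \<Longrightarrow> conjugate G x x = x"
  by (simp add: conjugate_def m_assoc)

lemma conjugate_mult:
  "x \<in> carrier G \<Longrightarrow> y \<in> carrier G \<Longrightarrow> z \<in> carrier G \<Longrightarrow>
    conjugate G (x \<otimes> y) z = conjugate G x (conjugate G y z)"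
  by (simp add: conjugate_def m_assoc inv_mult_group)

lemma conjugate_cancel [simp]:
  "x \<in> carrier G \<Longrightarrow> y \<in> carrier G \<Longrightarrow> z \<in> carrier G \<Longrightarrow>
    conjugate G x y = conjugate G x z \<longleftrightarrow> y = z"
  by (simp add: conjugate_def)

lemma in_conjugate_image_self_iff:
  assumes "x \<in> carrier G" "A \<subseteq> carrier G"
  shows "x \<in> conjugate G x ` A \<longleftrightarrow> x \<in> A"
proof -
  have "x = conjugate G x y \<longleftrightarrow> x = y" if "y \<in> A" for y
    using conjugate_cancel[of x x y] that assms by auto
  then show ?thesis by blast
qed

lemma inj_on_conjugate: "x \<in> carrier G \<Longrightarrow> A \<subseteq> carrier G \<Longrightarrow> inj_on (conjugate G x) A"
  by (rule inj_onI) (simp add: subset_iff)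

lemma conjugate_eq_iff_commute:
  assumes "x \<in> carrier G" "y \<in> carrier G"
  shows "conjugate G x y = y \<longleftrightarrow> x \<otimes> y = y \<otimes> x"
  using inv_solve_right[of y "x \<otimes> y" x] assms by (auto simp: conjugate_def)

lemma word_prod_in_generate: "set ws \<subseteq> H \<Longrightarrow> word_prod G ws \<in> generate G H"
  by (induction ws) (auto intro: generate.intros)

lemma word_prod_closed [simp]: "set ws \<subseteq> carrier G \<Longrightarrow> word_prod G ws \<in> carrier G"
  by (induction ws) auto

lemma word_prod_append:
  "set us \<subseteq> carrier G \<Longrightarrow> set vs \<subseteq> carrier G \<Longrightarrow>
    word_prod G (us @ vs) = word_prod G us \<otimes> word_prod G vs"
  by (induction us) (auto simp: m_assoc)

lemma reflections_subset_generate: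
  assumes "H \<subseteq> carrier G" "set ws \<subseteq> H"
  shows "set (reflections G ws) \<subseteq> generate G H"
  using assms(2)
proof (induction ws)
  case (Cons a ws)
  then have "a \<in> generate G H" "inv a \<in> generate G H"
    by (auto intro: generate.incl generate.inv)
  with Cons show ?case
    by (auto simp: conjugate_def intro!: generate.eng)
qed simp

lemma reflections_subset_carrier: "set ws \<subseteq> carrier G \<Longrightarrow> set (reflections G ws) \<subseteq> carrier G"
  using reflections_subset_generate[of "carrier G" ws] generate_incl[of "carrier G"] by auto

lemma reflections_append:
  assumes "set us \<subseteq> carrier G" "set vs \<subseteq> carrier G"
  shows "reflections G (us @ vs) =
    reflections G us @ map (conjugate G (word_prod G us)) (reflections G vs)"
  using assms
proof (induction us)
  case Nil
  have "map (conjugate G \<one>) (reflections G vs) = reflections G vs"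
    using reflections_subset_carrier[OF assms(2)] by (intro map_idI) auto
  then show ?case by simp
next
  case (Cons a us)
  then show ?case
    using reflections_subset_carrier[of vs] by (auto simp: conjugate_mult)
qed

lemma odd_elems_reflections_append:
  assumes "set us \<subseteq> carrier G" "set vs \<subseteq> carrier G"
  shows "odd_elems (reflections G (us @ vs)) = sym_diff (odd_elems (reflections G us))
    (conjugate G (word_prod G us) ` odd_elems (reflections G vs))"
  using assms reflections_subset_carrier[OF assms(2)]
  by (simp add: reflections_append odd_elems_append odd_elems_map inj_on_conjugate)

lemma distinct_reflections_Cons_iff:
  assumes "x \<in> carrier G" "set ws \<subseteq> carrier G"
  shows "distinct (reflections G (x # ws)) \<longleftrightarrow>
    x \<notin> set (reflections G ws) \<and> distinct (reflections G ws)"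
  using assms reflections_subset_carrier[OF assms(2)]
  by (simp add: distinct_map inj_on_conjugate in_conjugate_image_self_iff)

lemma word_prod_exchange:
  assumes "set ws \<subseteq> carrier G" "r \<in> set (reflections G ws)"
  obtains us x vs where "ws = us @ x # vs" "word_prod G ws = r \<otimes> word_prod G (us @ vs)"
  using assms
proof (induction ws arbitrary: r thesis)
  case (Cons a ws)
  then have ws: "set ws \<subseteq> carrier G" and a: "a \<in> carrier G" by auto
  show ?case
  proof (cases "r = a")
    case True
    then show ?thesis using Cons.prems(1)[of "[]" a ws] by simp
  next
    case False
    then obtain q where q: "q \<in> set (reflections G ws)" "r = conjugate G a q"
      using Cons.prems(3) by auto
    then have q_closed: "q \<in> carrier G" using reflections_subset_carrier[OF ws] by auto
    obtain us x vs where split: "ws = us @ x # vs" "word_prod G ws = q \<otimes> word_prod G (us @ vs)"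
      using Cons.IH ws q(1) by blast
    moreover have "inv a \<otimes> (a \<otimes> word_prod G (us @ vs)) = word_prod G (us @ vs)"
      using a ws split(1) by (simp flip: m_assoc)
    ultimately have "a \<otimes> (q \<otimes> word_prod G (us @ vs)) = r \<otimes> (a \<otimes> word_prod G (us @ vs))"
      unfolding q(2) conjugate_def using a ws q_closed by (simp add: m_assoc)
    then show ?thesis
      using Cons.prems(1)[of "a # us" x vs] split by simp
  qed
qed simp

end

section \<open>Inversion sets in Coxeter groups\<close>

context coxeter_system
begin

lemma gen_closed [simp]: "s \<in> S \<Longrightarrow> s \<in> carrier W"
  using gens_closed by auto

lemma gen_word_closed: "set ws \<subseteq> S \<Longrightarrow> set ws \<subseteq> carrier W"
  using gens_closed by auto

lemma gen_square: "s \<in> S \<Longrightarrow> s \<otimes> s = \<one>"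
  using order_two[of s] pow_ord_eq_1[of s] by (simp add: numeral_2_eq_2)

lemma inv_gen [simp]: "s \<in> S \<Longrightarrow> inv s = s"
  using gen_square[of s] by (simp add: inv_equality)

lemma gen_cancel [simp]: "s \<in> S \<Longrightarrow> x \<in> carrier W \<Longrightarrow> s \<otimes> (s \<otimes> x) = x"
  using gen_square[of s] by (simp flip: m_assoc)

lemma gen_neq_one: "s \<in> S \<Longrightarrow> s \<noteq> \<one>"
  using order_two[of s] by auto

lemma word_prod_rev: "set ws \<subseteq> S \<Longrightarrow> word_prod W (rev ws) = inv (word_prod W ws)"
  by (induction ws) (auto simp: word_prod_append gen_word_closed inv_mult_group)

lemma word_prod_alternating:
  assumes "s \<in> S" "t \<in> S"
  shows "word_prod W (concat (replicate n [s, t])) = (s \<otimes> t) [^] n"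
proof (induction n)
  case (Suc n)
  then have "word_prod W (concat (replicate (Suc n) [s, t])) = (s \<otimes> t) \<otimes> (s \<otimes> t) [^] n"
    using assms by (simp add: m_assoc)
  then show ?case
    using assms by (simp only: nat_pow_Suc2 m_closed gen_closed)
qed simp

lemma reflections_alternating:
  assumes "s \<in> S" "t \<in> S"
  shows "reflections W (concat (replicate n [s, t])) =
    map (\<lambda>j. (s \<otimes> t) [^] j \<otimes> s) [0..<2 * n]"
proof (induction n)
  case (Suc n)
  have shift: "conjugate W s (conjugate W t ((s \<otimes> t) [^] j \<otimes> s)) = (s \<otimes> t) [^] Suc (Suc j) \<otimes> s"
    for j :: nat
  proof -
    have "conjugate W s (conjugate W t ((s \<otimes> t) [^] j \<otimes> s)) =
        ((s \<otimes> t) \<otimes> (s \<otimes> t) [^] j) \<otimes> (s \<otimes> t) \<otimes> s"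
      using assms by (simp add: conjugate_def m_assoc)
    also have "(s \<otimes> t) \<otimes> (s \<otimes> t) [^] j = (s \<otimes> t) [^] Suc j"
      using assms by (simp only: nat_pow_Suc2 m_closed gen_closed)
    finally show ?thesis by simp
  qed
  have "[0..<2 * Suc n] = 0 # 1 # map (\<lambda>j. Suc (Suc j)) [0..<2 * n]"
    by (simp add: upt_conv_Cons map_Suc_upt flip: map_map[of Suc Suc, unfolded comp_def])
  moreover have "conjugate W s t = (s \<otimes> t) [^] (1::nat) \<otimes> s"
    using assms by (simp add: conjugate_def)
  ultimately show ?case
    using Suc assms shift by simp
qed simp

text \<open>The reflections \<open>(st)\<^sup>j s\<close> with \<open>j < 2 m\<close> of the word \<open>(st)\<^sup>m\<close> have period \<open>m\<close>.\<close>

lemma odd_elems_reflections_relation: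
  assumes "s \<in> S" "t \<in> S"
  shows "odd_elems (reflections W (concat (replicate (ord (s \<otimes> t)) [s, t]))) = {}"
proof -
  let ?m = "ord (s \<otimes> t)" and ?f = "\<lambda>j::nat. (s \<otimes> t) [^] j \<otimes> s"
  have "?f (j + ?m) = ?f j" for j
    using assms nat_pow_mult[of "s \<otimes> t" j ?m, symmetric] by simp
  moreover have "[0..<2 * ?m] = [0..<?m] @ map (\<lambda>j. j + ?m) [0..<?m]"
    using upt_add_eq_append[of 0 ?m ?m] by (simp add: map_add_upt mult_2)
  ultimately have "map ?f [0..<2 * ?m] = map ?f [0..<?m] @ map ?f [0..<?m]"
    by simp
  then show ?thesis
    using assms by (simp add: reflections_alternating odd_elems_append)
qed

lemma word_equiv_subset_iff:
  "word_equiv W S us vs \<Longrightarrow> set us \<subseteq> S \<longleftrightarrow> set vs \<subseteq> S"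
  by (induction rule: word_equiv.induct) (auto simp: set_replicate_conv_if split: if_splits)

lemma word_equiv_odd_elems_reflections:
  assumes "word_equiv W S us vs" "set us \<subseteq> S"
  shows "odd_elems (reflections W us) = odd_elems (reflections W vs)"
  using assms
proof (induction rule: word_equiv.induct)
  case (relation s t us vs)
  define rel where "rel = concat (replicate (ord (s \<otimes> t)) [s, t])"
  have words: "set rel \<subseteq> carrier W" "set us \<subseteq> carrier W" "set vs \<subseteq> carrier W"
    using relation gens_closed by (auto simp: rel_def set_replicate_conv_if)
  have rel_one: "word_prod W rel = \<one>"
    using relation by (simp add: rel_def word_prod_alternating)
  have "conjugate W \<one> ` odd_elems (reflections W vs) = odd_elems (reflections W vs)"
    using odd_elems_subset[of "reflections W vs"] reflections_subset_carrier[OF words(3)]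
    by (force simp: image_iff)
  then have "odd_elems (reflections W (rel @ vs)) = odd_elems (reflections W vs)"
    using odd_elems_reflections_relation[OF relation(1,2)] words
    by (simp add: odd_elems_reflections_append rel_one flip: rel_def)
  then show ?case
    using words by (simp add: odd_elems_reflections_append flip: rel_def)
next
  case (sym us vs)
  then show ?case by (simp add: word_equiv_subset_iff)
next
  case (trans us vs ws)
  then show ?case by (simp add: word_equiv_subset_iff)
qed simp

lemma odd_elems_reflections_eq_empty:
  assumes "set ws \<subseteq> S" "word_prod W ws = \<one>"
  shows "odd_elems (reflections W ws) = {}"
  using word_equiv_odd_elems_reflections[OF presentation] assms by simp

lemma odd_elems_reflections_cong:
  assumes "set us \<subseteq> S" "set vs \<subseteq> S" "word_prod W us = word_prod W vs"
  shows "odd_elems (reflections W us) = odd_elems (reflections W vs)"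
proof -
  have "odd_elems (reflections W (ws @ rev vs)) = {}"
    if "set ws \<subseteq> S" "word_prod W ws = word_prod W vs" for ws
    using that assms
    by (intro odd_elems_reflections_eq_empty)
      (auto simp: word_prod_append word_prod_rev gen_word_closed)
  from this[of us] this[of vs] show ?thesis
    using assms by (simp add: odd_elems_reflections_append gen_word_closed) blast
qed

lemma generate_wordE:
  assumes "K \<subseteq> S" "w \<in> generate W K"
  obtains ws where "set ws \<subseteq> K" "word_prod W ws = w"
proof -
  have "\<exists>ws. set ws \<subseteq> K \<and> word_prod W ws = w"
    using assms(2)
  proof (induction rule: generate.induct)
    case one
    show ?case by (intro exI[of _ "[]"]) simp
  next
    case (incl h)
    then show ?case using assms(1) by (intro exI[of _ "[h]"]) auto
  next
    case (inv h)
    then show ?case using assms(1) by (intro exI[of _ "[h]"]) (auto simp: subset_iff)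
  next
    case (eng h1 h2)
    then obtain us vs where "set us \<subseteq> K" "set vs \<subseteq> K"
      "word_prod W us = h1" "word_prod W vs = h2"
      by auto
    then show ?case
      using assms(1) by (intro exI[of _ "us @ vs"]) (auto simp: word_prod_append gen_word_closed)
  qed
  then show ?thesis using that by blast
qed

definition inversions :: "'a \<Rightarrow> 'a set"
  where "inversions w = (\<Union>ws \<in> {ws \<in> lists S. word_prod W ws = w}. odd_elems (reflections W ws))"

lemma inversions_word_prod:
  assumes "set ws \<subseteq> S"
  shows "inversions (word_prod W ws) = odd_elems (reflections W ws)"
  using assms odd_elems_reflections_cong[of _ ws] unfolding inversions_def by blast

lemma inversions_reduced:
  "set ws \<subseteq> S \<Longrightarrow> distinct (reflections W ws) \<Longrightarrow>
    inversions (word_prod W ws) = set (reflections W ws)"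
  by (simp add: inversions_word_prod odd_elems_distinct)

lemma inversions_gen: "s \<in> S \<Longrightarrow> inversions s = {s}"
  using inversions_reduced[of "[s]"] by simp

lemma inversions_mult:
  assumes "u \<in> carrier W" "v \<in> carrier W"
  shows "inversions (u \<otimes> v) = sym_diff (inversions u) (conjugate W u ` inversions v)"
proof -
  obtain us vs where words: "set us \<subseteq> S" "set vs \<subseteq> S" "word_prod W us = u" "word_prod W vs = v"
    using assms generate_wordE[of S] generates by (metis subset_refl)
  then have "inversions (u \<otimes> v) = odd_elems (reflections W (us @ vs))"
    using inversions_word_prod[of "us @ vs"] by (simp add: word_prod_append gen_word_closed)
  then show ?thesis
    using words inversions_word_prod[of us] inversions_word_prod[of vs]
    by (simp add: odd_elems_reflections_append gen_word_closed)
qed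

lemma inversions_subset_parabolic:
  assumes "K \<subseteq> S" "w \<in> generate W K"
  shows "inversions w \<subseteq> generate W K"
proof -
  obtain ws where ws: "set ws \<subseteq> K" "word_prod W ws = w"
    using generate_wordE assms .
  then have "inversions w = odd_elems (reflections W ws)"
    using inversions_word_prod[of ws] assms by auto
  also have "\<dots> \<subseteq> set (reflections W ws)"
    by (rule odd_elems_subset)
  also have "\<dots> \<subseteq> generate W K"
    using reflections_subset_generate[of K ws] ws(1) assms gens_closed by blast
  finally show ?thesis .
qed

lemma inversions_subset_carrier: "w \<in> carrier W \<Longrightarrow> inversions w \<subseteq> carrier W"
  using inversions_subset_parabolic[of S w] generates by simp

lemma reduced_word_Cons_cases:
  assumes "k \<in> S" "set us \<subseteq> S" "distinct (reflections W us)"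
  obtains (reduced) "distinct (reflections W (k # us))"
    | (shorter) vs where "set vs \<subseteq> set us" "length vs < length us"
        "word_prod W vs = k \<otimes> word_prod W us"
proof (cases "k \<in> set (reflections W us)")
  case True
  have us_closed: "set us \<subseteq> carrier W" using assms(2) by (rule gen_word_closed)
  obtain xs x ys where split: "us = xs @ x # ys"
    and exchanged: "word_prod W us = k \<otimes> word_prod W (xs @ ys)"
    using word_prod_exchange us_closed True .
  have "word_prod W (xs @ ys) = k \<otimes> word_prod W us"
    unfolding exchanged using assms(1) us_closed split by simp
  then show ?thesis using shorter[of "xs @ ys"] split by auto
next
  case False
  then show ?thesis
    using reduced assms distinct_reflections_Cons_iff[of k us] gen_word_closed by simp
qed

lemma reduced_word_exists:
  assumes "K \<subseteq> S" "set ws \<subseteq> K"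
  obtains vs where "set vs \<subseteq> K" "length vs \<le> length ws" "word_prod W vs = word_prod W ws"
    "distinct (reflections W vs)"
  using assms(2)
proof (induction "length ws" arbitrary: ws thesis rule: less_induct)
  case less
  show ?case
  proof (cases ws)
    case Nil
    then show ?thesis using less.prems(1)[of "[]"] by simp
  next
    case (Cons k tail)
    obtain us where us: "set us \<subseteq> K" "length us \<le> length tail"
      "word_prod W us = word_prod W tail" "distinct (reflections W us)"
      using less.hyps[of tail] less.prems(2) Cons by auto
    have "k \<in> K" "k \<in> S" "set us \<subseteq> S" using less.prems(2) Cons us(1) assms(1) by auto
    from this(2,3) us(4) show ?thesis
    proof (cases rule: reduced_word_Cons_cases)
      case reduced
      then show ?thesis using less.prems(1)[of "k # us"] us(1-3) \<open>k \<in> K\<close> Cons by simp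
    next
      case (shorter vs)
      then have "set vs \<subseteq> K" "length vs < length ws" "word_prod W vs = word_prod W ws"
        using us(1-3) Cons by auto
      then show ?thesis
        using less.hyps[of vs] less.prems(1) by (metis less_imp_le order_trans)
    qed
  qed
qed

lemma generate_reduced_wordE:
  assumes "K \<subseteq> S" "w \<in> generate W K"
  obtains ws where "set ws \<subseteq> K" "word_prod W ws = w" "distinct (reflections W ws)"
proof -
  obtain us where us: "set us \<subseteq> K" "word_prod W us = w"
    using generate_wordE assms .
  then show ?thesis
    using reduced_word_exists[OF assms(1) us(1)] that by metis
qed

lemma finite_inversions:
  assumes "w \<in> carrier W"
  shows "finite (inversions w)"
proof -
  obtain ws where "set ws \<subseteq> S" "word_prod W ws = w" "distinct (reflections W ws)"
    using generate_reduced_wordE[of S w] assms generates by auto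
  then show ?thesis using inversions_reduced[of ws] by auto
qed

lemma cox_length_eq_card_inversions:
  assumes "w \<in> carrier W"
  shows "cox_length W S w = card (inversions w)"
  unfolding cox_length_def
proof (rule Least_equality)
  obtain ws where ws: "set ws \<subseteq> S" "word_prod W ws = w" "distinct (reflections W ws)"
    using generate_reduced_wordE[of S w] assms generates by auto
  then have "length ws = card (inversions w)"
    using inversions_reduced[of ws] distinct_card[of "reflections W ws"] by simp
  with ws show "\<exists>ws. set ws \<subseteq> S \<and> length ws = card (inversions w) \<and> word_prod W ws = w"
    by blast
next
  fix n
  assume "\<exists>ws. set ws \<subseteq> S \<and> length ws = n \<and> word_prod W ws = w"
  then obtain ws where ws: "set ws \<subseteq> S" "length ws = n" "word_prod W ws = w" by blast
  then have "inversions w \<subseteq> set (reflections W ws)"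
    using inversions_word_prod[of ws] odd_elems_subset[of "reflections W ws"] by simp
  then have "card (inversions w) \<le> card (set (reflections W ws))"
    by (simp add: card_mono)
  also have "\<dots> \<le> n"
    using card_length[of "reflections W ws"] ws(2) by simp
  finally show "card (inversions w) \<le> n" .
qed

lemma cox_length_gen_mult_neq:
  assumes "s \<in> S" "w \<in> carrier W"
  shows "cox_length W S (s \<otimes> w) \<noteq> cox_length W S w"
proof -
  let ?N = "conjugate W s ` inversions w"
  have "finite ?N" using finite_inversions[OF assms(2)] by simp
  moreover have "card ?N = card (inversions w)"
    using assms inversions_subset_carrier by (intro card_image inj_on_conjugate) auto
  moreover have "inversions (s \<otimes> w) = (if s \<in> ?N then ?N - {s} else insert s ?N)"
    using assms by (auto simp: inversions_mult inversions_gen)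
  ultimately have "card (inversions (s \<otimes> w)) \<noteq> card (inversions w)"
    using card_Suc_Diff1[of ?N s] by (cases "s \<in> ?N") simp_all
  then show ?thesis
    using assms by (simp add: cox_length_eq_card_inversions)
qed

section \<open>Parabolic subgroups and irreducibility\<close>

lemma parabolic_closed: "K \<subseteq> S \<Longrightarrow> w \<in> generate W K \<Longrightarrow> w \<in> carrier W"
  using generate_in_carrier gens_closed by blast

lemma gen_in_parabolic_iff:
  assumes "K \<subseteq> S" "t \<in> S"
  shows "t \<in> generate W K \<longleftrightarrow> t \<in> K"
proof
  assume "t \<in> generate W K"
  then obtain ws where ws: "set ws \<subseteq> K" "word_prod W ws = t" "distinct (reflections W ws)"
    using generate_reduced_wordE assms(1) by blast
  then have "set (reflections W ws) = {t}"
    using inversions_reduced[of ws] inversions_gen assms by auto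
  then have "length ws = 1"
    using distinct_card[OF ws(3)] by simp
  then obtain k where "ws = [k]" by (auto simp: length_Suc_conv)
  then show "t \<in> K" using ws assms by auto
qed (rule generate.incl)

text \<open>
  As \<open>t \<notin> W\<^sub>K\<close>, the inversions \<open>t\<close> and \<open>(t w) t (t w)\<^sup>-\<^sup>1\<close> contributed by the two outer letters of
  \<open>t w t \<in> W\<^sub>K\<close> must cancel.
\<close>

lemma conjugate_parabolic_imp_commute:
  assumes "K \<subseteq> S" "t \<in> S - K" "w \<in> generate W K" "conjugate W t w \<in> generate W K"
  shows "t \<otimes> w = w \<otimes> t"
proof -
  have t_gen: "t \<in> S" and w_closed: "w \<in> carrier W"
    using assms parabolic_closed by auto
  have "t \<notin> generate W K" using assms gen_in_parabolic_iff by blast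
  then have t_notin: "t \<notin> inversions w" "t \<notin> inversions (conjugate W t w)"
    using assms inversions_subset_parabolic by blast+
  have "t \<notin> conjugate W t ` inversions w"
    using t_notin(1) t_gen by (simp add: in_conjugate_image_self_iff inversions_subset_carrier w_closed)
  moreover have "inversions (conjugate W t w) =
      sym_diff {t} (conjugate W t ` sym_diff (inversions w) {conjugate W w t})"
    using t_gen w_closed by (simp add: conjugate_def[of W t w] m_assoc inversions_mult inversions_gen)
  ultimately have "t = conjugate W t (conjugate W w t)"
    using t_notin(2) t_gen by auto
  then have "conjugate W w t = t"
    using conjugate_cancel[of t t "conjugate W w t"] t_gen w_closed by simp
  then show ?thesis
    using conjugate_eq_iff_commute[of w t] t_gen w_closed by simp
qed

lemma conjugate_inversions_eq:
  assumes "t \<in> S" "w \<in> carrier W" "t \<otimes> w = w \<otimes> t"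
  shows "conjugate W t ` inversions w = inversions w"
proof -
  have "conjugate W w t = t" using assms conjugate_eq_iff_commute by simp
  then have "sym_diff {t} (conjugate W t ` inversions w) = sym_diff (inversions w) {t}"
    using assms inversions_mult[of t w] inversions_mult[of w t] by (simp add: inversions_gen)
  then show ?thesis by blast
qed

lemma reduced_word_letters_commute:
  assumes "K \<subseteq> S" "t \<in> S - K" "set ws \<subseteq> K" "distinct (reflections W ws)"
    "t \<otimes> word_prod W ws = word_prod W ws \<otimes> t"
  shows "\<forall>k\<in>set ws. t \<otimes> k = k \<otimes> t"
  using assms(3-5)
proof (induction ws)
  case (Cons k ws)
  let ?w = "word_prod W (k # ws)"
  have t_gen: "t \<in> S" and k_gen: "k \<in> K" "k \<in> S" and ws_closed: "word_prod W ws \<in> carrier W"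
    using Cons.prems(1) assms(1,2) gens_closed by auto
  have "k \<in> inversions ?w"
    using inversions_reduced[of "k # ws"] Cons.prems assms(1) by auto
  then have "conjugate W t k \<in> inversions ?w"
    using conjugate_inversions_eq[of t ?w] t_gen k_gen ws_closed Cons.prems(3) by auto
  also have "inversions ?w \<subseteq> generate W K"
    using inversions_subset_parabolic assms(1) Cons.prems(1) by (blast intro: word_prod_in_generate)
  finally have commute: "t \<otimes> k = k \<otimes> t"
    using conjugate_parabolic_imp_commute assms(1,2) k_gen by (blast intro: generate.incl)
  have "k \<otimes> (t \<otimes> word_prod W ws) = t \<otimes> ?w"
    using t_gen k_gen ws_closed commute by (simp flip: m_assoc)
  also have "\<dots> = k \<otimes> (word_prod W ws \<otimes> t)"
    using Cons.prems(3) t_gen k_gen ws_closed by (simp add: m_assoc)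
  finally have "t \<otimes> word_prod W ws = word_prod W ws \<otimes> t"
    using t_gen k_gen ws_closed by simp
  moreover have "distinct (reflections W ws)"
    using Cons.prems(2) by (simp add: distinct_map)
  ultimately show ?case
    using Cons.IH Cons.prems(1) commute by simp
qed simp

lemma conjugate_parabolic_imp_centralizer:
  assumes "K \<subseteq> S" "t \<in> S - K" "w \<in> generate W K" "conjugate W t w \<in> generate W K"
  shows "w \<in> generate W {k \<in> K. t \<otimes> k = k \<otimes> t}"
proof -
  obtain ws where ws: "set ws \<subseteq> K" "word_prod W ws = w" "distinct (reflections W ws)"
    using generate_reduced_wordE assms(1,3) .
  then have "\<forall>k\<in>set ws. t \<otimes> k = k \<otimes> t"
    using reduced_word_letters_commute[OF assms(1,2)] conjugate_parabolic_imp_commute[OF assms]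
    by simp
  then show ?thesis
    using ws word_prod_in_generate[of ws "{k \<in> K. t \<otimes> k = k \<otimes> t}"] by auto
qed

lemma parabolic_mult_gens_imp_eq:
  assumes "K \<subseteq> S" "t \<in> S - K" "u \<in> S" "w \<in> generate W K" "t \<otimes> w \<otimes> u \<in> generate W K"
  shows "u = t"
proof -
  have w: "w \<in> carrier W" "inv w \<in> generate W K"
    using assms parabolic_closed generate_m_inv_closed gens_closed by blast+
  have "generate W K \<subseteq> generate W (insert u K)"
    by (rule mono_generate) auto
  then have "t \<otimes> w \<otimes> u \<otimes> u \<otimes> inv w \<in> generate W (insert u K)"
    using assms(5) w(2) by (auto intro: generate.intros)
  moreover have "t \<otimes> w \<otimes> u \<otimes> u \<otimes> inv w = t"
    using w(1) assms by (simp add: m_assoc)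
  ultimately show ?thesis
    using gen_in_parabolic_iff[of "insert u K" t] assms by auto
qed

lemma ord_commuting_gens:
  assumes "s \<in> S" "t \<in> S" "s \<noteq> t" "s \<otimes> t = t \<otimes> s"
  shows "ord (s \<otimes> t) = 2"
proof -
  have "(s \<otimes> t) [^] (2::nat) = (s \<otimes> t) \<otimes> (t \<otimes> s)"
    using assms by (simp add: numeral_2_eq_2)
  also have "\<dots> = \<one>"
    using assms(1,2) by (simp add: m_assoc gen_square)
  finally have "ord (s \<otimes> t) dvd 2"
    using pow_eq_id[of "s \<otimes> t"] assms by simp
  moreover have "s \<otimes> t \<noteq> \<one>"
    using assms by (metis gen_closed inv_equality inv_gen)
  then have "ord (s \<otimes> t) \<noteq> 1"
    using ord_eq_1 assms by simp
  ultimately show ?thesis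
    using two_is_prime_nat prime_nat_iff by blast
qed

lemma irreducible_noncommutingE:
  assumes "irreducible_coxeter W S" "K \<subset> S" "K \<noteq> {}"
  obtains t k where "t \<in> S - K" "k \<in> K" "t \<otimes> k \<noteq> k \<otimes> t"
proof -
  have "\<exists>t\<in>S - K. \<exists>k\<in>K. t \<otimes> k \<noteq> k \<otimes> t"
  proof (rule ccontr)
    assume "\<not> ?thesis"
    then have commute: "t \<otimes> k = k \<otimes> t" if "t \<in> S - K" "k \<in> K" for t k
      using that by blast
    obtain s k where s: "s \<in> S - K" and k: "k \<in> K" using assms(2,3) by blast
    then have "(s, k) \<in> (coxeter_diagram W S)\<^sup>*"
      using assms(1,2) by (auto simp: irreducible_coxeter_def)
    then have "k \<notin> K"
    proof (induction rule: rtrancl_induct)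
      case base
      show ?case using s by simp
    next
      case (step x y)
      then show ?case
        using commute[of x y] ord_commuting_gens[of x y] by (auto simp: coxeter_diagram_def)
    qed
    with k show False by contradiction
  qed
  then show ?thesis using that by blast
qed

end

section \<open>Residues and codistances\<close>

lemma (in building) dist_gen_sym:
  assumes "C \<in> Ch" "D \<in> Ch" "\<delta> C D \<in> S"
  shows "\<delta> D C = \<delta> C D"
proof -
  have closed: "\<delta> D C \<in> carrier W" using assms dist_closed by simp
  have "\<delta> D C \<noteq> \<one>"
    using assms WD1[of C D] WD1[of D C] gen_neq_one by auto
  moreover have "\<delta> C C = \<one>" using assms WD1 by simp
  then have "\<one> \<in> {\<delta> C D \<otimes> \<delta> D C, \<delta> D C}"
    using WD2[of D C C "\<delta> C D"] assms by simp
  ultimately have "\<delta> C D \<otimes> \<delta> D C = \<one>" by auto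
  then show ?thesis
    using gen_cancel[OF assms(3) closed] assms(3) by simp
qed

context twin_building
begin

lemma half_unique: "C \<in> Ch \<epsilon> \<Longrightarrow> C \<in> Ch \<eta> \<Longrightarrow> \<epsilon> = \<eta>"
  using disjoint by (cases \<epsilon>; cases \<eta>) auto

lemma in_twin_chambers_iff: "C \<in> twin_chambers Ch \<longleftrightarrow> (\<exists>\<epsilon>. C \<in> Ch \<epsilon>)"
  unfolding twin_chambers_def by (metis (full_types) Un_iff)

definition residue :: "'a set \<Rightarrow> bool \<Rightarrow> 'c \<Rightarrow> 'c set"
  where "residue K \<epsilon> C = {D \<in> Ch \<epsilon>. \<delta> \<epsilon> C D \<in> generate W K}"

lemma is_residue_iff:
  "is_residue W S Ch \<delta> K \<epsilon> R \<longleftrightarrow> K \<subseteq> S \<and> (\<exists>C\<in>Ch \<epsilon>. R = residue K \<epsilon> C)"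
  by (simp add: is_residue_def residue_def)

lemma residue_subset: "residue K \<epsilon> C \<subseteq> Ch \<epsilon>"
  by (auto simp: residue_def)

lemma residue_self:
  assumes "C \<in> Ch \<epsilon>"
  shows "C \<in> residue K \<epsilon> C"
proof -
  interpret building W S "Ch \<epsilon>" "\<delta> \<epsilon>" by (rule halves)
  show ?thesis using assms WD1[of C C] by (simp add: residue_def generate.one)
qed

lemma residue_empty:
  assumes "C \<in> Ch \<epsilon>"
  shows "residue {} \<epsilon> C = {C}"
proof -
  interpret building W S "Ch \<epsilon>" "\<delta> \<epsilon>" by (rule halves)
  show ?thesis using assms WD1 by (auto simp: residue_def generate_empty)
qed

lemma residue_gens:
  assumes "C \<in> Ch \<epsilon>"
  shows "residue S \<epsilon> C = Ch \<epsilon>"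
proof -
  interpret building W S "Ch \<epsilon>" "\<delta> \<epsilon>" by (rule halves)
  show ?thesis using assms dist_closed by (auto simp: residue_def generates)
qed

lemma residue_half_unique:
  assumes "is_residue W S Ch \<delta> K \<epsilon> R" "is_residue W S Ch \<delta> L \<eta> R"
  shows "\<epsilon> = \<eta>"
proof -
  obtain C where "C \<in> Ch \<epsilon>" "C \<in> R" using assms(1) residue_self by (auto simp: is_residue_iff)
  moreover have "R \<subseteq> Ch \<eta>" using assms(2) residue_subset by (auto simp: is_residue_iff)
  ultimately show ?thesis using half_unique by blast
qed

lemma adjacent_in_residue_iff:
  assumes "K \<subseteq> S" "C \<in> Ch \<epsilon>" "D \<in> Ch \<epsilon>" "\<delta> \<epsilon> C D \<in> S"
  shows "D \<in> residue K \<epsilon> C \<longleftrightarrow> \<delta> \<epsilon> C D \<in> K"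
  using assms by (simp add: residue_def gen_in_parabolic_iff)

lemma codist_adjacent_left:
  assumes "C \<in> Ch \<epsilon>" "C' \<in> Ch \<epsilon>" "D \<in> Ch (\<not> \<epsilon>)" "s \<in> S" "\<delta> \<epsilon> C' C = s"
  shows "\<delta>s C' D \<in> {\<delta>s C D, s \<otimes> \<delta>s C D}"
proof -
  interpret building W S "Ch \<epsilon>" "\<delta> \<epsilon>" by (rule halves)
  have closed: "\<delta>s C D \<in> carrier W" using assms codist_closed by auto
  obtain E where E: "E \<in> Ch \<epsilon>" "\<delta> \<epsilon> E C = s" "\<delta>s E D = s \<otimes> \<delta>s C D"
    using Tw3 assms by blast
  have "\<delta> \<epsilon> C E = s" using dist_gen_sym[of E C] E assms by simp
  then have "\<delta> \<epsilon> C' E \<in> {\<one>, s}"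
    using WD2[of C E C' s] E assms gen_square by auto
  then consider (same) "C' = E" | (adjacent) "\<delta> \<epsilon> C' E = s"
    using WD1 E(1) assms(2) by auto
  then show ?thesis
  proof cases
    case same
    then show ?thesis using E(3) by simp
  next
    case adjacent
    consider (descent_from_C) "cox_length W S (s \<otimes> \<delta>s C D) < cox_length W S (\<delta>s C D)"
      | (descent_from_E) "cox_length W S (s \<otimes> \<delta>s E D) < cox_length W S (\<delta>s E D)"
      using cox_length_gen_mult_neq[OF assms(4) closed] E(3) assms(4) closed by fastforce
    then show ?thesis
    proof cases
      case descent_from_C
      then show ?thesis using Tw2[of C \<epsilon> D C' s] assms by simp
    next
      case descent_from_E
      then have "\<delta>s C' D = s \<otimes> \<delta>s E D"
        using Tw2[of E \<epsilon> D C' s] E(1) assms adjacent by simp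
      then show ?thesis using E(3) closed assms(4) by simp
    qed
  qed
qed

lemma codist_adjacent_right:
  assumes "C \<in> Ch \<epsilon>" "D \<in> Ch (\<not> \<epsilon>)" "D' \<in> Ch (\<not> \<epsilon>)" "s \<in> S" "\<delta> (\<not> \<epsilon>) D' D = s"
  shows "\<delta>s C D' \<in> {\<delta>s C D, \<delta>s C D \<otimes> s}"
proof -
  have closed: "\<delta>s D C \<in> carrier W" using assms codist_closed[of D "\<not> \<epsilon>" C] by simp
  have "\<delta>s D' C \<in> {\<delta>s D C, s \<otimes> \<delta>s D C}"
    using codist_adjacent_left[of D "\<not> \<epsilon>" D' C s] assms by simp
  then show ?thesis
    using Tw1[of C \<epsilon> D] Tw1[of C \<epsilon> D'] assms closed by (auto simp: inv_mult_group)
qed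

lemma codist_parabolic_adjacent_iff:
  assumes "L \<subseteq> S" "C \<in> Ch \<epsilon>" "D \<in> Ch (\<not> \<epsilon>)" "D' \<in> Ch (\<not> \<epsilon>)" "\<delta> (\<not> \<epsilon>) D' D \<in> L"
  shows "\<delta>s C D' \<in> generate W L \<longleftrightarrow> \<delta>s C D \<in> generate W L"
proof -
  let ?s = "\<delta> (\<not> \<epsilon>) D' D"
  have s_gen: "?s \<in> S" "?s \<in> generate W L" using assms by (auto intro: generate.incl)
  have closed: "\<delta>s C D \<in> carrier W" using assms codist_closed by blast
  have "\<delta>s C D \<otimes> ?s \<otimes> ?s = \<delta>s C D"
    using closed s_gen by (simp add: m_assoc gen_square)
  then have "\<delta>s C D \<otimes> ?s \<in> generate W L \<longleftrightarrow> \<delta>s C D \<in> generate W L"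
    using s_gen(2) by (metis generate.eng)
  moreover have "\<delta>s C D' \<in> {\<delta>s C D, \<delta>s C D \<otimes> ?s}"
    using codist_adjacent_right[of C \<epsilon> D D' ?s] s_gen assms by simp
  ultimately show ?thesis by auto
qed

lemma codist_parabolic_residue_iff:
  assumes "L \<subseteq> S" "C \<in> Ch \<epsilon>" "D \<in> Ch (\<not> \<epsilon>)" "D' \<in> residue L (\<not> \<epsilon>) D"
  shows "\<delta>s C D' \<in> generate W L \<longleftrightarrow> \<delta>s C D \<in> generate W L"
proof -
  interpret building W S "Ch (\<not> \<epsilon>)" "\<delta> (\<not> \<epsilon>)" by (rule halves)
  have D'_in: "D' \<in> Ch (\<not> \<epsilon>)" using assms(4) residue_subset by blast
  obtain ws where "set ws \<subseteq> L" "word_prod W ws = \<delta> (\<not> \<epsilon>) D D'"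
    using generate_wordE assms(1,4) by (auto simp: residue_def)
  then show ?thesis using assms(3)
  proof (induction ws arbitrary: D)
    case Nil
    then show ?case using WD1[of D D'] D'_in by simp
  next
    case (Cons k ws)
    have k_gen: "k \<in> L" "k \<in> S" and ws_closed: "set ws \<subseteq> carrier W"
      using Cons.prems(1) assms(1) gens_closed by auto
    obtain E where E: "E \<in> Ch (\<not> \<epsilon>)" "\<delta> (\<not> \<epsilon>) E D = k"
      "\<delta> (\<not> \<epsilon>) E D' = k \<otimes> \<delta> (\<not> \<epsilon>) D D'"
      using WD3 Cons.prems(3) D'_in k_gen by blast
    then have "word_prod W ws = \<delta> (\<not> \<epsilon>) E D'"
      using k_gen ws_closed by (simp flip: Cons.prems(2))
    then have "\<delta>s C D' \<in> generate W L \<longleftrightarrow> \<delta>s C E \<in> generate W L"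
      using Cons.IH Cons.prems(1) E(1) by simp
    also have "\<dots> \<longleftrightarrow> \<delta>s C D \<in> generate W L"
      using codist_parabolic_adjacent_iff assms(1,2) Cons.prems(3) E(1,2) k_gen(1) by blast
    finally show ?case .
  qed
qed

section \<open>Opposite residues\<close>

lemma opposite_residuesE:
  assumes "opposite_residues W S Ch \<delta> \<delta>s P Q" "C \<in> P" "P \<subseteq> Ch \<epsilon>"
  obtains D where "D \<in> Q" "D \<in> Ch (\<not> \<epsilon>)" "\<delta>s C D = \<one>"
  using assms half_unique unfolding opposite_residues_def opposite_def by blast

lemma opposite_residues_codist:
  assumes "opposite_residues W S Ch \<delta> \<delta>s P Q" "P \<subseteq> Ch \<epsilon>"
    and "is_residue W S Ch \<delta> L (\<not> \<epsilon>) Q" "C \<in> P" "D \<in> Q"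
  shows "\<delta>s C D \<in> generate W L"
proof -
  obtain E where L: "L \<subseteq> S" and E: "E \<in> Ch (\<not> \<epsilon>)" and Q: "Q = residue L (\<not> \<epsilon>) E"
    using assms(3) by (auto simp: is_residue_iff)
  obtain D' where D': "D' \<in> Q" "\<delta>s C D' = \<one>"
    using opposite_residuesE assms(1,4,2) .
  have "C \<in> Ch \<epsilon>" using assms(2,4) by blast
  then have "\<delta>s C D \<in> generate W L \<longleftrightarrow> \<delta>s C D' \<in> generate W L"
    using codist_parabolic_residue_iff[OF L _ E] assms(5) D'(1) Q by blast
  then show ?thesis
    using D'(2) by (simp add: generate.one)
qed

lemma opposite_residues_type_subset:
  assumes "opposite_residues W S Ch \<delta> \<delta>s P Q"
    and "is_residue W S Ch \<delta> K \<epsilon> P" "is_residue W S Ch \<delta> L (\<not> \<epsilon>) Q"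
  shows "K \<subseteq> L"
proof
  fix k assume k: "k \<in> K"
  interpret building W S "Ch \<epsilon>" "\<delta> \<epsilon>" by (rule halves)
  obtain C where K: "K \<subseteq> S" and C: "C \<in> Ch \<epsilon>" and P: "P = residue K \<epsilon> C"
    using assms(2) by (auto simp: is_residue_iff)
  have C_in: "C \<in> P" using C P residue_self by simp
  have P_sub: "P \<subseteq> Ch \<epsilon>" using P residue_subset by simp
  obtain D where D: "D \<in> Q" "D \<in> Ch (\<not> \<epsilon>)" "\<delta>s C D = \<one>"
    using opposite_residuesE assms(1) C_in P_sub .
  have "k \<in> S" using k K by blast
  then obtain C' where C': "C' \<in> Ch \<epsilon>" "\<delta> \<epsilon> C' C = k" "\<delta>s C' D = k"
    using Tw3[OF C D(2)] D(3) by auto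
  then have "C' \<in> P"
    using adjacent_in_residue_iff[OF K C] dist_gen_sym[of C' C] C P k \<open>k \<in> S\<close> by simp
  then have "k \<in> generate W L"
    using opposite_residues_codist[OF assms(1) P_sub assms(3)] D(1) C'(3) by blast
  then show "k \<in> L"
    using gen_in_parabolic_iff[of L k] assms(3) \<open>k \<in> S\<close> by (simp add: is_residue_iff)
qed

lemma J_opposite_residueE:
  assumes "J_opposite W S Ch \<delta> \<delta>s J \<theta>" "C \<in> Ch \<epsilon>"
  obtains L where "is_residue W S Ch \<delta> L (\<not> \<epsilon>) (\<theta> ` residue (S - J) \<epsilon> C)"
    "opposite_residues W S Ch \<delta> \<delta>s (residue (S - J) \<epsilon> C) (\<theta> ` residue (S - J) \<epsilon> C)"
proof -
  let ?R = "residue (S - J) \<epsilon> C"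
  have R: "is_residue W S Ch \<delta> (S - J) \<epsilon> ?R"
    using assms(2) by (auto simp: is_residue_iff)
  then have opp: "opposite_residues W S Ch \<delta> \<delta>s ?R (\<theta> ` ?R)"
    using assms(1) by (simp add: J_opposite_def)
  then obtain \<eta> K L where "is_residue W S Ch \<delta> K \<eta> ?R" "is_residue W S Ch \<delta> L (\<not> \<eta>) (\<theta> ` ?R)"
    by (auto simp: opposite_residues_def)
  with that opp R show ?thesis
    using residue_half_unique by blast
qed

lemma J_opposite_swaps_halves:
  assumes "J_opposite W S Ch \<delta> \<delta>s J \<theta>" "C \<in> Ch \<epsilon>"
  shows "\<theta> C \<in> Ch (\<not> \<epsilon>)"
proof -
  obtain L where "is_residue W S Ch \<delta> L (\<not> \<epsilon>) (\<theta> ` residue (S - J) \<epsilon> C)"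
    using J_opposite_residueE assms .
  then show ?thesis
    using residue_self[OF assms(2)] residue_subset unfolding is_residue_iff by blast
qed

lemma J_opposite_gens_iff:
  "J_opposite W S Ch \<delta> \<delta>s S \<theta> \<longleftrightarrow> (\<forall>C\<in>twin_chambers Ch. opposite W Ch \<delta>s C (\<theta> C))"
proof
  assume opp: "\<forall>C\<in>twin_chambers Ch. opposite W Ch \<delta>s C (\<theta> C)"
  have singleton: "is_residue W S Ch \<delta> {} \<epsilon> R \<longleftrightarrow> (\<exists>C\<in>Ch \<epsilon>. R = {C})" for \<epsilon> R
    by (auto simp: is_residue_iff residue_empty)
  have "opposite_residues W S Ch \<delta> \<delta>s {C} {\<theta> C}" if "C \<in> Ch \<epsilon>" for C \<epsilon>
  proof -
    have "opposite W Ch \<delta>s C (\<theta> C)"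
      using opp that in_twin_chambers_iff by blast
    then show ?thesis
      using singleton unfolding opposite_residues_def opposite_def by blast
  qed
  then show "J_opposite W S Ch \<delta> \<delta>s S \<theta>"
    by (auto simp: J_opposite_def singleton)
next
  assume "J_opposite W S Ch \<delta> \<delta>s S \<theta>"
  then have "opposite_residues W S Ch \<delta> \<delta>s {C} {\<theta> C}" if "C \<in> Ch \<epsilon>" for C \<epsilon>
    using J_opposite_residueE[of S \<theta> C \<epsilon>] that by (simp add: residue_empty)
  then show "\<forall>C\<in>twin_chambers Ch. opposite W Ch \<delta>s C (\<theta> C)"
    by (auto simp: in_twin_chambers_iff opposite_residues_def)
qed

end

section \<open>Maps exchanging the two halves\<close>

locale half_swapping_map = twin_building W S Ch \<delta> \<delta>s
  for W (structure) and S and Ch :: "bool \<Rightarrow> 'c set" and \<delta> and \<delta>s +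
  fixes \<theta> :: "'c \<Rightarrow> 'c"
  assumes swaps: "C \<in> Ch \<epsilon> \<Longrightarrow> \<theta> C \<in> Ch (\<not> \<epsilon>)"
    and adjacency: "C \<in> Ch \<epsilon> \<Longrightarrow> D \<in> Ch \<epsilon> \<Longrightarrow> \<delta> \<epsilon> C D \<in> S \<Longrightarrow>
      \<delta> (\<not> \<epsilon>) (\<theta> C) (\<theta> D) \<in> S"
begin

text \<open>
  Opposition forces the type \<open>L\<close> of the image of an \<open>S - {s}\<close>-residue to contain \<open>S - {s}\<close>. If it
  were all of \<open>S\<close>, the image would be a whole half, contradicting injectivity.
\<close>

lemma singleton_opposite_codist_parabolic:
  assumes "inj_on \<theta> (twin_chambers Ch)" "s \<in> S"
    and opp: "J_opposite W S Ch \<delta> \<delta>s {s} \<theta>" and C: "C \<in> Ch \<epsilon>"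
  shows "\<delta>s C (\<theta> C) \<in> generate W (S - {s})"
proof -
  interpret building W S "Ch \<epsilon>" "\<delta> \<epsilon>" by (rule halves)
  let ?R = "residue (S - {s}) \<epsilon> C"
  have R: "is_residue W S Ch \<delta> (S - {s}) \<epsilon> ?R"
    using C by (auto simp: is_residue_iff)
  obtain L where L: "is_residue W S Ch \<delta> L (\<not> \<epsilon>) (\<theta> ` ?R)"
    and opp_R: "opposite_residues W S Ch \<delta> \<delta>s ?R (\<theta> ` ?R)"
    using J_opposite_residueE opp C .
  have "S - {s} \<subseteq> L" "L \<subseteq> S"
    using opposite_residues_type_subset[OF opp_R R L] L by (auto simp: is_residue_iff)
  moreover have "L \<noteq> S"
  proof
    assume "L = S"
    then have full: "\<theta> ` ?R = Ch (\<not> \<epsilon>)"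
      using L residue_gens by (auto simp: is_residue_iff)
    obtain D where D: "D \<in> Ch \<epsilon>" "\<delta> \<epsilon> D C = s" using WD3[OF C C assms(2)] by blast
    then have "D \<notin> ?R"
      using adjacent_in_residue_iff[of "S - {s}" C \<epsilon> D] dist_gen_sym[of D C] C assms(2) by simp
    moreover have "?R \<subseteq> twin_chambers Ch" "D \<in> twin_chambers Ch"
      using residue_subset D(1) in_twin_chambers_iff by blast+
    ultimately have "\<theta> D \<notin> \<theta> ` ?R"
      using inj_on_image_mem_iff[OF assms(1)] by blast
    with full swaps[OF D(1)] show False by simp
  qed
  ultimately have "L = S - {s}" by blast
  then show ?thesis
    using opposite_residues_codist[OF opp_R residue_subset L] residue_self[OF C] by blast
qed

lemma codist_image_in_centralizer:
  assumes K: "K \<subseteq> S" and codist: "\<And>\<epsilon> C. C \<in> Ch \<epsilon> \<Longrightarrow> \<delta>s C (\<theta> C) \<in> generate W K"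
    and t: "t \<in> S - K" and C: "C \<in> Ch \<epsilon>"
  shows "\<delta>s C (\<theta> C) \<in> generate W {k \<in> K. t \<otimes> k = k \<otimes> t}"
proof -
  let ?w = "\<delta>s C (\<theta> C)"
  have w: "?w \<in> generate W K" "?w \<in> carrier W" "inv ?w \<in> generate W K"
    using codist[OF C] parabolic_closed[OF K] generate_m_inv_closed K gens_closed by blast+
  obtain C' where C': "C' \<in> Ch \<epsilon>" "\<delta> \<epsilon> C' C = t" "\<delta>s C' (\<theta> C) = t \<otimes> ?w"
    using Tw3[OF C swaps[OF C]] t by blast
  define u where "u = \<delta> (\<not> \<epsilon>) (\<theta> C') (\<theta> C)"
  have u_gen: "u \<in> S" using adjacency[OF C'(1) C] C'(2) t by (simp add: u_def)
  have "\<delta>s C' (\<theta> C') \<in> {t \<otimes> ?w, t \<otimes> ?w \<otimes> u}"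
    using codist_adjacent_right[OF C'(1) swaps[OF C] swaps[OF C'(1)] u_gen] C'(3) by (simp add: u_def)
  moreover have "t \<otimes> ?w \<notin> generate W K"
  proof
    assume "t \<otimes> ?w \<in> generate W K"
    then have "t \<otimes> ?w \<otimes> inv ?w \<in> generate W K" using w(3) by (rule generate.eng)
    then have "t \<in> generate W K" using w(2) t by (simp add: m_assoc)
    then show False using gen_in_parabolic_iff[OF K] t by blast
  qed
  ultimately have twu_in: "t \<otimes> ?w \<otimes> u \<in> generate W K"
    using codist[OF C'(1)] by auto
  then have "u = t"
    using parabolic_mult_gens_imp_eq K t u_gen w(1) by blast
  then have "conjugate W t ?w \<in> generate W K"
    using twu_in u_gen by (simp add: conjugate_def)
  then show ?thesis
    using conjugate_parabolic_imp_centralizer K t w(1) by blast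
qed

lemma codist_image_eq_one:
  assumes "irreducible_coxeter W S" "finite K" "K \<subset> S"
    and "\<And>\<epsilon> C. C \<in> Ch \<epsilon> \<Longrightarrow> \<delta>s C (\<theta> C) \<in> generate W K" "C \<in> Ch \<epsilon>"
  shows "\<delta>s C (\<theta> C) = \<one>"
  using assms(2-5)
proof (induction K arbitrary: C \<epsilon> rule: finite_psubset_induct)
  case (psubset K)
  show ?case
  proof (cases "K = {}")
    case True
    then show ?thesis using psubset.prems(2,3) generate_empty by blast
  next
    case False
    then obtain t k where t: "t \<in> S - K" and k: "k \<in> K" "t \<otimes> k \<noteq> k \<otimes> t"
      using irreducible_noncommutingE assms(1) psubset.prems(1) by blast
    let ?K' = "{k \<in> K. t \<otimes> k = k \<otimes> t}"
    have "?K' \<subset> K" using k by blast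
    moreover have "\<delta>s C (\<theta> C) \<in> generate W ?K'" if "C \<in> Ch \<epsilon>" for C \<epsilon>
      using codist_image_in_centralizer psubset.prems(1,2) t that by blast
    ultimately show ?thesis
      using psubset.IH[of ?K'] psubset.prems(1,3) by blast
  qed
qed

end

lemma (in twin_building) twin_automorphism_imp_half_swapping_map:
  assumes "twin_automorphism W S Ch \<delta> \<delta>s \<theta>" "J_opposite W S Ch \<delta> \<delta>s J \<theta>"
  shows "half_swapping_map W S Ch \<delta> \<delta>s \<theta>"
proof
  show swaps: "\<theta> C \<in> Ch (\<not> \<epsilon>)" if "C \<in> Ch \<epsilon>" for C \<epsilon>
    using J_opposite_swaps_halves assms(2) that .
  show "\<delta> (\<not> \<epsilon>) (\<theta> C) (\<theta> D) \<in> S" if "C \<in> Ch \<epsilon>" "D \<in> Ch \<epsilon>" "\<delta> \<epsilon> C D \<in> S" for C D \<epsilon>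
  proof -
    have "adjacent S Ch \<delta> C D" using that unfolding adjacent_def by blast
    then have "adjacent S Ch \<delta> (\<theta> C) (\<theta> D)"
      using assms(1) that in_twin_chambers_iff unfolding twin_automorphism_def by blast
    then show ?thesis
      using half_unique swaps[OF that(1)] unfolding adjacent_def by blast
  qed
qed

theorem lemma4p3:
  fixes W :: "('w, 'x) monoid_scheme" and S :: "'w set"
    and Ch :: "bool \<Rightarrow> 'c set" and \<delta> :: "bool \<Rightarrow> 'c \<Rightarrow> 'c \<Rightarrow> 'w" and \<delta>s :: "'c \<Rightarrow> 'c \<Rightarrow> 'w"
    and \<theta> :: "'c \<Rightarrow> 'c" and s :: 'w
  assumes "finite S"
    and "irreducible_coxeter W S"
    and "twin_building W S Ch \<delta> \<delta>s"
    and "twin_automorphism W S Ch \<delta> \<delta>s \<theta>"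
    and "s \<in> S"
    and "J_opposite W S Ch \<delta> \<delta>s {s} \<theta>"
  shows "J_opposite W S Ch \<delta> \<delta>s S \<theta> \<and>
    (\<forall>C\<in>twin_chambers Ch. opposite W Ch \<delta>s C (\<theta> C))"
proof -
  interpret twin_building W S Ch \<delta> \<delta>s by fact
  interpret half_swapping_map W S Ch \<delta> \<delta>s \<theta>
    using twin_automorphism_imp_half_swapping_map assms(4,6) .
  have "inj_on \<theta> (twin_chambers Ch)"
    using assms(4) by (simp add: twin_automorphism_def bij_betw_def)
  then have "\<delta>s C (\<theta> C) \<in> generate W (S - {s})" if "C \<in> Ch \<epsilon>" for C \<epsilon>
    using singleton_opposite_codist_parabolic assms(5,6) that by blast
  then have "\<delta>s C (\<theta> C) = \<one>\<^bsub>W\<^esub>" if "C \<in> Ch \<epsilon>" for C \<epsilon>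
    using codist_image_eq_one[of "S - {s}"] assms(1,2,5) that by blast
  then have "opposite W Ch \<delta>s C (\<theta> C)" if "C \<in> Ch \<epsilon>" for C \<epsilon>
    using swaps[OF that] that unfolding opposite_def by blast
  then show ?thesis by (auto simp: J_opposite_gens_iff in_twin_chambers_iff)
qed

end
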